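(* Let $n$ and $t$ be integers and let $G$ be an $n$-vertex graph such that $G \ast K_t$ does not have a Hamiltonian cycle. Then the following bounds on $e(G)$ hold. (i) If $n+t$ is even, then $$e(G) \le \binom{n}{2} - \begin{cases} t(n-1) - \binom{t}{2} & \text{if } t \le (n+4)/5, \\ \binom{\frac{n+t+2}{2}}{2} - 1 & \text{if } t \ge (n+4)/5. \end{cases}$$ (ii) If $n+t$ is odd, then $$e(G) \le \binom{n}{2} - \begin{cases} t(n-1) - \binom{t}{2} & \text{if } t \le (n+1)/5, \\ \binom{\frac{n+t+1}{2}}{2} & \text{if } t \ge (n+1)/5. \end{cases}$$ In the case where $n+t$ is even and $t = (n+4)/5$, or $n+t$ is odd and $t = (n+1)/5$, there are exactly two graphs $G$ which achieve equality. In all other cases there is a unique $G$ for which the equality holds.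
   Context: Graphs are finite and simple, $e(G)$ denotes the number of edges of $G$, and graphs achieving equality are counted up to isomorphism. For a graph $G$ and an integer $t \ge 0$, the join $G \ast K_t$ is the graph obtained from $G$ by adding $t$ new vertices and all edges incident to at least one of the new vertices (so the new vertices are adjacent to each other and to all vertices of $G$).
   Formalization: The counts of graphs achieving equality are stated only for 1 ≤ t < n: for t = 0, n ≥ 3 and for t ≥ n, n+t ≥ 3 no graph attains equality, and for n = t = 1 there is one graph, not two; the other excluded pairs have n+t ≤ 2. The bounds hold for all n, t ≥ 0. *)

theory Defs
  imports Complex_Main
begin

record 'a ugraph =
  verts :: "'a set"
  edges :: "'a set set"

definition simple_graph :: "'a ugraph \<Rightarrow> bool" where
  "simple_graph G \<longleftrightarrow>
     finite (verts G) \<and> (\<forall>e\<in>edges G. e \<subseteq> verts G \<and> card e = 2)"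

definition graph_iso :: "'a ugraph \<Rightarrow> 'b ugraph \<Rightarrow> bool" where
  "graph_iso G H \<longleftrightarrow>
     (\<exists>f. bij_betw f (verts G) (verts H) \<and>
          (\<forall>x\<in>verts G. \<forall>y\<in>verts G. {x, y} \<in> edges G \<longleftrightarrow> {f x, f y} \<in> edges H))"

text \<open>The join of \<open>G\<close> with the complete graph on \<open>t\<close> new vertices;
  the new vertices are \<open>Inr 0, \<dots>, Inr (t - 1)\<close>.\<close>

definition join_complete :: "'a ugraph \<Rightarrow> nat \<Rightarrow> ('a + nat) ugraph" where
  "join_complete G t =
     \<lparr> verts = Inl ` verts G \<union> Inr ` {..<t},
       edges = (\<lambda>e. Inl ` e) ` edges G \<union>
         {{x, y} | x y. x \<in> Inr ` {..<t} \<and> y \<in> Inl ` verts G \<union> Inr ` {..<t} \<and> x \<noteq> y} \<rparr>"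

text \<open>A cycle has at least three vertices, so the complete graphs on one and on two
  vertices have no Hamiltonian cycle.\<close>

definition hamiltonian_cycle :: "'a ugraph \<Rightarrow> 'a list \<Rightarrow> bool" where
  "hamiltonian_cycle G vs \<longleftrightarrow>
     length vs \<ge> 3 \<and> distinct vs \<and> set vs = verts G \<and>
     (\<forall>i<length vs. {vs ! i, vs ! (Suc i mod length vs)} \<in> edges G)"

definition join_nonhamiltonian :: "nat \<Rightarrow> nat \<Rightarrow> 'a ugraph \<Rightarrow> bool" where
  "join_nonhamiltonian n t G \<longleftrightarrow>
     simple_graph G \<and> card (verts G) = n \<and> (\<nexists>vs. hamiltonian_cycle (join_complete G t) vs)"

text \<open>On the overlap of the two ranges of \<open>t\<close>, i.e. when \<open>t\<close> equals the threshold, the two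
  expressions have the same value, so the order of the tests is immaterial.\<close>

definition edge_bound :: "nat \<Rightarrow> nat \<Rightarrow> int" where
  "edge_bound n t = int (n choose 2) -
     (if even (n + t)
      then if real t \<le> (real n + 4) / 5
           then int t * (int n - 1) - int (t choose 2)
           else int (((n + t + 2) div 2) choose 2) - 1
      else if real t \<le> (real n + 1) / 5
           then int t * (int n - 1) - int (t choose 2)
           else int (((n + t + 1) div 2) choose 2))"

text \<open>Every finite graph is isomorphic to one whose vertices are natural numbers, so counting
  isomorphism classes on the type \<open>nat\<close> counts all finite graphs up to isomorphism.\<close>

definition extremal_graphs :: "nat \<Rightarrow> nat \<Rightarrow> nat ugraph set" where
  "extremal_graphs n t =
     {G. join_nonhamiltonian n t G \<and> int (card (edges G)) = edge_bound n t}"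

definition num_extremal_graphs :: "nat \<Rightarrow> nat \<Rightarrow> nat" where
  "num_extremal_graphs n t = card (extremal_graphs n t // {(G, H). graph_iso G H})"

end

(* Apply Chvatal's theorem to H = G * K_t on N = n + t vertices: if H is not Hamiltonian, then for
   some i < N/2 there are i vertices of degree at most i and N - i vertices (among them the former)
   of degree at most N - i - 1.  The minimum degree of H is at least t, so i >= t, and no vertex of
   K_t has such a small degree, so these are conditions on G.  Summing degrees shows that G has at
   least i (2 N - 3 i - 1) / 2 non-edges.  This is strictly concave in i, hence minimal only at the
   ends of the range of i, and the threshold for t is where the two ends agree.  Equality in the
   degree sum determines G. *)

theory Submission
  imports Defs
begin

text \<open>Degree information is first gained in an edge-maximal non-Hamiltonian supergraph, where
  any two non-adjacent vertices are the ends of a Hamiltonian path. Only upper bounds on degrees are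
  kept, since these survive when the extra edges are removed again. Within the join, an extremal
  graph becomes the join of \<open>K_i\<close> with the disjoint union of \<open>i\<close> isolated
  vertices and \<open>K_(N - 2i)\<close>. Hence its number of non-edges depends on \<open>N\<close>
  and \<open>i\<close> only. It has no Hamiltonian cycle for \<open>i \<ge> 1\<close>, because
  deleting the \<open>i\<close> dominating vertices leaves \<open>i + 1\<close> components. The
  equality case needs \<open>1 \<le> t < n\<close>. For \<open>t = 0\<close> only the complete graph
  could attain the bound, and it is Hamiltonian as soon as \<open>n \<ge> 3\<close>. For
  \<open>t \<ge> n\<close> no \<open>i\<close> satisfies \<open>t \<le> i\<close> and
  \<open>2 * i < n + t\<close>, so with \<open>n + t \<ge> 3\<close> every join is Hamiltonian. Edge
  counts are doubled throughout to keep binomial coefficients free of division.\<close>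

section \<open>Neighbourhoods and the degree sum\<close>

definition nbrs :: "'a ugraph \<Rightarrow> 'a \<Rightarrow> 'a set" where
  "nbrs G x = {y. {x, y} \<in> edges G}"

definition degree :: "'a ugraph \<Rightarrow> 'a \<Rightarrow> nat" where
  "degree G x = card (nbrs G x)"

lemma simple_graph_edgeD:
  assumes "simple_graph G" "{x, y} \<in> edges G"
  shows "x \<in> verts G" "y \<in> verts G" "x \<noteq> y"
  using assms by (force simp: simple_graph_def)+

lemma simple_graph_finite_edges: "simple_graph G \<Longrightarrow> finite (edges G)"
  unfolding simple_graph_def
  by (rule finite_subset[where B = "Pow (verts G)"]) auto

lemma nbrs_subset: "simple_graph G \<Longrightarrow> nbrs G x \<subseteq> verts G - {x}"
  by (auto simp: nbrs_def dest: simple_graph_edgeD)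

lemma finite_nbrs: "simple_graph G \<Longrightarrow> finite (nbrs G x)"
  by (rule finite_subset[OF nbrs_subset]) (auto simp: simple_graph_def)

lemma sum_degree:
  assumes "simple_graph G"
  shows "(\<Sum>x\<in>verts G. degree G x) = 2 * card (edges G)"
proof -
  have fin: "finite (verts G)"
    using assms by (simp add: simple_graph_def)
  have deg: "degree G x = card {e \<in> edges G. x \<in> e}" for x
  proof -
    have "{e \<in> edges G. x \<in> e} = (\<lambda>y. {x, y}) ` nbrs G x"
    proof (intro equalityI subsetI)
      fix e assume e: "e \<in> {e \<in> edges G. x \<in> e}"
      then have "card e = 2" using assms by (simp add: simple_graph_def)
      then obtain y where "e = {x, y}"
        using e by (auto simp: card_2_iff)
      then show "e \<in> (\<lambda>y. {x, y}) ` nbrs G x"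
        using e by (auto simp: nbrs_def)
    qed (auto simp: nbrs_def)
    moreover have "inj_on (\<lambda>y. {x, y}) (nbrs G x)"
      by (auto simp: inj_on_def doubleton_eq_iff)
    ultimately show ?thesis
      by (simp add: degree_def card_image)
  qed
  have "(\<Sum>x\<in>verts G. card {e \<in> edges G. x \<in> e}) = 2 * card (edges G)"
  proof (rule sum_multicount)
    show "\<forall>e\<in>edges G. card {x \<in> verts G. x \<in> e} = 2"
    proof
      fix e assume "e \<in> edges G"
      then have "e \<subseteq> verts G" "card e = 2" using assms by (auto simp: simple_graph_def)
      moreover from this have "{x \<in> verts G. x \<in> e} = e" by auto
      ultimately show "card {x \<in> verts G. x \<in> e} = 2" by simp
    qed
  qed (use fin assms simple_graph_finite_edges in auto)
  then show ?thesis by (simp add: deg)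
qed

section \<open>Hamiltonian cycles and Hamiltonian paths\<close>

text \<open>Separating the closing edge, which is the index \<open>length vs - 1\<close>, makes the
  cycle accessible to the list lemmas on appending and reversing. The indexed form remains the
  convenient one for rotations.\<close>

lemma hamiltonian_cycle_iff_successively:
  "hamiltonian_cycle G vs \<longleftrightarrow>
     length vs \<ge> 3 \<and> distinct vs \<and> set vs = verts G \<and>
     successively (\<lambda>x y. {x, y} \<in> edges G) vs \<and> {last vs, hd vs} \<in> edges G"
proof -
  have "(\<forall>i<length vs. {vs ! i, vs ! (Suc i mod length vs)} \<in> edges G) \<longleftrightarrow>
      successively (\<lambda>x y. {x, y} \<in> edges G) vs \<and> {last vs, hd vs} \<in> edges G"
    if "length vs \<ge> 3"
  proof -
    have "vs \<noteq> []" using that by auto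
    then have ends: "last vs = vs ! (length vs - 1)" "hd vs = vs ! 0"
      by (simp_all add: last_conv_nth hd_conv_nth)
    have split: "(\<forall>i<length vs. Q i) \<longleftrightarrow> (\<forall>i. Suc i < length vs \<longrightarrow> Q i) \<and> Q (length vs - 1)" for Q
      using that by (metis Suc_lessI Suc_lessD diff_Suc_1 diff_less less_le_trans zero_less_numeral zero_less_one)
    have "Suc (length vs - 1) = length vs"
      using that by simp
    then show ?thesis
      unfolding successively_conv_nth ends split by (simp del: One_nat_def)
  qed
  then show ?thesis unfolding hamiltonian_cycle_def by auto
qed

lemma hamiltonian_cycle_rotate:
  assumes "hamiltonian_cycle G vs"
  shows "hamiltonian_cycle G (rotate m vs)"
proof -
  have "{vs ! ((m + i) mod length vs), vs ! ((m + Suc i mod length vs) mod length vs)} \<in> edges G"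
    if "i < length vs" for i
  proof -
    have "(m + i) mod length vs < length vs"
      using that by (intro mod_less_divisor) linarith
    moreover have "(m + Suc i mod length vs) mod length vs = Suc ((m + i) mod length vs) mod length vs"
      by (simp add: mod_simps)
    ultimately show ?thesis
      using assms unfolding hamiltonian_cycle_def by metis
  qed
  moreover have "Suc i mod length vs < length vs" if "i < length vs" for i
    using that by (intro mod_less_divisor) linarith
  ultimately show ?thesis
    using assms unfolding hamiltonian_cycle_def by (simp add: nth_rotate)
qed

definition hamiltonian_path :: "'a ugraph \<Rightarrow> 'a list \<Rightarrow> bool" where
  "hamiltonian_path G vs \<longleftrightarrow>
     distinct vs \<and> set vs = verts G \<and> successively (\<lambda>x y. {x, y} \<in> edges G) vs"

lemma hamiltonian_path_rev: "hamiltonian_path G vs \<Longrightarrow> hamiltonian_path G (rev vs)"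
  unfolding hamiltonian_path_def by (simp add: insert_commute)

text \<open>The cycle has to use the new edge. Rotating it until that edge is the closing one and
  then dropping the edge leaves a path in \<open>G\<close>; a reversal puts \<open>u\<close> in
  front if necessary.\<close>

lemma hamiltonian_path_if_cycle_insert:
  assumes cyc: "hamiltonian_cycle (G\<lparr>edges := insert {u, v} (edges G)\<rparr>) vs"
    and nham: "\<not> hamiltonian_cycle G vs"
  obtains ws where "hamiltonian_path G ws" "length ws = length vs" "hd ws = u" "last ws = v"
proof -
  let ?G = "G\<lparr>edges := insert {u, v} (edges G)\<rparr>"
  let ?L = "length vs"
  have L: "?L \<ge> 3" using cyc by (simp add: hamiltonian_cycle_def)
  obtain k where k: "k < ?L" "{vs ! k, vs ! (Suc k mod ?L)} \<notin> edges G"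
    using cyc nham unfolding hamiltonian_cycle_def by auto
  then have kuv: "{vs ! k, vs ! (Suc k mod ?L)} = {u, v}"
    using cyc unfolding hamiltonian_cycle_def by auto
  define ws where "ws = rotate (Suc k) vs"
  have cw: "hamiltonian_cycle ?G ws"
    unfolding ws_def by (rule hamiltonian_cycle_rotate[OF cyc])
  have lw: "length ws = ?L" by (simp add: ws_def)
  have ne: "ws \<noteq> []" using lw L by auto
  have hdw: "hd ws = vs ! (Suc k mod ?L)"
    using ne lw L nth_rotate[of 0 vs "Suc k"] by (simp add: hd_conv_nth ws_def)
  have "last ws = vs ! ((Suc k + (?L - 1)) mod ?L)"
    using ne lw L nth_rotate[of "?L - 1" vs "Suc k"] by (simp add: last_conv_nth ws_def)
  moreover have "Suc k + (?L - 1) = k + ?L" using L by simp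
  ultimately have lastw: "last ws = vs ! k" using k by simp
  have uv: "{last ws, hd ws} = {u, v}" using hdw lastw kuv by simp
  have dw: "distinct ws" using cw by (simp add: hamiltonian_cycle_def)
  have "{ws ! i, ws ! Suc i} \<in> edges G" if i: "Suc i < ?L" for i
  proof (rule ccontr)
    assume c: "{ws ! i, ws ! Suc i} \<notin> edges G"
    have "{ws ! i, ws ! Suc i} \<in> edges ?G"
      using cw i lw unfolding hamiltonian_cycle_iff_successively successively_conv_nth by simp
    with c have "{ws ! i, ws ! Suc i} = {ws ! (?L - 1), ws ! 0}"
      using uv ne lw by (auto simp: last_conv_nth hd_conv_nth)
    \<comment> \<open>The new edge cannot occur a second time: positions \<open>i\<close> and
      \<open>Suc i\<close> would have to be the two ends of the list, which happens only for length
      2.\<close>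
    then have "(i = ?L - 1 \<and> Suc i = 0) \<or> (i = 0 \<and> Suc i = ?L - 1)"
      using dw i lw L
      by (smt (verit, best) Suc_lessD diff_less doubleton_eq_iff gr0I less_numeral_extra(1) 
          nth_eq_iff_index_eq not_numeral_le_zero)
    then show False using L by linarith
  qed
  then have pw: "hamiltonian_path G ws"
    using cw lw unfolding hamiltonian_path_def hamiltonian_cycle_def successively_conv_nth by simp
  show thesis
  proof (cases "hd ws = u")
    case True
    then have "last ws = v" using uv by (auto simp: doubleton_eq_iff)
    then show thesis using that True pw lw by blast
  next
    case False
    then have "hd ws = v" "last ws = u" using uv by (auto simp: doubleton_eq_iff)
    then show thesis
      using that[of "rev ws"] hamiltonian_path_rev[OF pw] lw ne by (simp add: hd_rev last_rev)
  qed
qed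

text \<open>The classical exchange: follow the path from its head to position \<open>j\<close>, jump
  to the last vertex, run backwards to position \<open>Suc j\<close>, and return to the
  head.\<close>

lemma hamiltonian_cycle_crossing:
  assumes p: "hamiltonian_path G ws" and L: "length ws \<ge> 3" and j: "Suc j < length ws"
    and "{hd ws, ws ! Suc j} \<in> edges G" "{last ws, ws ! j} \<in> edges G"
  shows "hamiltonian_cycle G (take (Suc j) ws @ rev (drop (Suc j) ws))"
proof -
  have split: "successively (\<lambda>x y. {x, y} \<in> edges G) (take (Suc j) ws @ drop (Suc j) ws)"
    using p by (simp add: hamiltonian_path_def)
  have "last (take (Suc j) ws) = ws ! j"
    using j by (simp add: take_Suc_conv_app_nth)
  moreover have "hd (take (Suc j) ws) = hd ws" "hd (drop (Suc j) ws) = ws ! Suc j"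
    "last (drop (Suc j) ws) = last ws" "take (Suc j) ws \<noteq> []" "drop (Suc j) ws \<noteq> []"
    using j by (auto simp: hd_drop_conv_nth)
  moreover have "set (take (Suc j) ws) \<union> set (drop (Suc j) ws) = set ws"
    by (metis append_take_drop_id set_append)
  moreover have "set (take (Suc j) ws) \<inter> set (drop (Suc j) ws) = {}"
    using p by (simp add: hamiltonian_path_def set_take_disj_set_drop_if_distinct)
  ultimately show ?thesis
    using assms split
    unfolding hamiltonian_cycle_iff_successively successively_append_iff hamiltonian_path_def
    by (simp add: hd_rev last_rev insert_commute)
qed

text \<open>The set \<open>A\<close> consists of the path predecessors of the neighbours of the
  head. None of them is adjacent to the last vertex, as that would close a cycle by crossing. The
  same disjointness bounds the degree sum of the two ends.\<close>

lemma degree_sum_less_if_hamiltonian_path: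
  assumes G: "simple_graph G" and nham: "\<nexists>vs. hamiltonian_cycle G vs"
    and p: "hamiltonian_path G ws" and L: "length ws \<ge> 3"
  obtains A where "A \<subseteq> verts G - {last ws}" "card A = degree G (hd ws)"
    "\<And>x. x \<in> A \<Longrightarrow> {x, last ws} \<notin> edges G"
    "degree G (hd ws) + degree G (last ws) < card (verts G)"
proof -
  let ?L = "length ws"
  define S where "S = {j. Suc j < ?L \<and> {hd ws, ws ! Suc j} \<in> edges G}"
  define T where "T = {j. Suc j < ?L \<and> {last ws, ws ! j} \<in> edges G}"
  have ne: "ws \<noteq> []" using L by auto
  have d: "distinct ws" and sv: "set ws = verts G" using p by (auto simp: hamiltonian_path_def)
  have disj: "S \<inter> T = {}"
    using hamiltonian_cycle_crossing[OF p L] nham unfolding S_def T_def by blast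
  have fin: "finite S" "finite T" unfolding S_def T_def by (auto intro: finite_subset[of _ "{..<?L}"])
  have "nbrs G (hd ws) = (\<lambda>j. ws ! Suc j) ` S"
  proof (intro equalityI subsetI)
    fix y assume y: "y \<in> nbrs G (hd ws)"
    then have "y \<in> set ws" "y \<noteq> ws ! 0"
      using nbrs_subset[OF G] sv ne by (auto simp: hd_conv_nth)
    then obtain k where "k < ?L" "y = ws ! k" "k \<noteq> 0"
      by (metis in_set_conv_nth)
    then show "y \<in> (\<lambda>j. ws ! Suc j) ` S"
      using y by (intro image_eqI[of _ _ "k - 1"]) (auto simp: S_def nbrs_def)
  qed (auto simp: S_def nbrs_def)
  moreover have "inj_on (\<lambda>j. ws ! Suc j) S"
    using d by (auto simp: inj_on_def S_def nth_eq_iff_index_eq)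
  ultimately have cS: "card S = degree G (hd ws)"
    by (simp add: degree_def card_image)
  have "nbrs G (last ws) = (\<lambda>j. ws ! j) ` T"
  proof (intro equalityI subsetI)
    fix y assume y: "y \<in> nbrs G (last ws)"
    then have "y \<in> set ws" "y \<noteq> ws ! (?L - 1)"
      using nbrs_subset[OF G] sv ne by (auto simp: last_conv_nth)
    then obtain k where "k < ?L" "y = ws ! k" "k \<noteq> ?L - 1"
      by (metis in_set_conv_nth)
    then show "y \<in> (\<lambda>j. ws ! j) ` T"
      using y by (intro image_eqI[of _ _ k]) (auto simp: T_def nbrs_def)
  qed (auto simp: T_def nbrs_def)
  moreover have "inj_on (\<lambda>j. ws ! j) T" "inj_on (\<lambda>j. ws ! j) S"
    using d by (auto simp: inj_on_def S_def T_def nth_eq_iff_index_eq)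
  ultimately have cT: "card T = degree G (last ws)"
    by (simp add: degree_def card_image)
  \<comment> \<open>Only the positions below \<open>?L - 1\<close> have a successor, which makes the
    final inequality strict.\<close>
  have "card (S \<union> T) \<le> card {..<?L - 1}"
    by (intro card_mono) (auto simp: S_def T_def)
  then have "card S + card T < ?L"
    using L disj fin by (simp add: card_Un_disjoint)
  moreover have "?L = card (verts G)"
    using d sv distinct_card by metis
  ultimately have sum: "degree G (hd ws) + degree G (last ws) < card (verts G)"
    using cS cT by simp
  show thesis
  proof (rule that[of "(\<lambda>j. ws ! j) ` S"])
    show "(\<lambda>j. ws ! j) ` S \<subseteq> verts G - {last ws}"
    proof
      fix x assume "x \<in> (\<lambda>j. ws ! j) ` S"
      then obtain j where "Suc j < ?L" "x = ws ! j" by (auto simp: S_def)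
      then show "x \<in> verts G - {last ws}"
        using d ne unfolding sv[symmetric] by (simp add: last_conv_nth nth_eq_iff_index_eq)
    qed
    show "card ((\<lambda>j. ws ! j) ` S) = degree G (hd ws)"
      using \<open>inj_on (\<lambda>j. ws ! j) S\<close> cS by (simp add: card_image)
    show "{x, last ws} \<notin> edges G" if x: "x \<in> (\<lambda>j. ws ! j) ` S" for x
    proof -
      obtain j where j: "j \<in> S" "x = ws ! j" using x by blast
      then have "j \<notin> T" "Suc j < ?L" using disj by (auto simp: S_def)
      then show ?thesis using j by (simp add: T_def insert_commute)
    qed
  qed (fact sum)
qed

section \<open>Edge-maximal non-Hamiltonian graphs and Chvatal's theorem\<close>

text \<open>This guarantees that an edge-maximal non-Hamiltonian graph on at least three vertices
  still has a non-adjacent pair.\<close>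

lemma hamiltonian_cycle_complete:
  assumes "finite (verts G)" "card (verts G) \<ge> 3"
    and "\<And>x y. x \<in> verts G \<Longrightarrow> y \<in> verts G \<Longrightarrow> x \<noteq> y \<Longrightarrow> {x, y} \<in> edges G"
  shows "\<exists>vs. hamiltonian_cycle G vs"
proof -
  obtain vs where vs: "set vs = verts G" "distinct vs"
    using assms finite_distinct_list by metis
  have L: "length vs \<ge> 3" using vs assms distinct_card by metis
  have "{vs ! i, vs ! (Suc i mod length vs)} \<in> edges G" if i: "i < length vs" for i
  proof (rule assms(3))
    have m: "Suc i mod length vs < length vs" using i by (intro mod_less_divisor) linarith
    then show "vs ! i \<in> verts G" "vs ! (Suc i mod length vs) \<in> verts G"
      using i vs nth_mem by metis+
    have "i \<noteq> Suc i mod length vs"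
      using i L by (cases "Suc i = length vs") auto
    then show "vs ! i \<noteq> vs ! (Suc i mod length vs)"
      using i m vs by (simp add: nth_eq_iff_index_eq)
  qed
  then show ?thesis using L vs unfolding hamiltonian_cycle_def by blast
qed

lemma maximal_nonhamiltonian:
  assumes "simple_graph G" "\<nexists>vs. hamiltonian_cycle G vs"
  obtains E where "edges G \<subseteq> E" "simple_graph (G\<lparr>edges := E\<rparr>)"
    "\<nexists>vs. hamiltonian_cycle (G\<lparr>edges := E\<rparr>) vs"
    "\<And>u v. u \<in> verts G \<Longrightarrow> v \<in> verts G \<Longrightarrow> u \<noteq> v \<Longrightarrow> {u, v} \<notin> E \<Longrightarrow>
       \<exists>vs. hamiltonian_cycle (G\<lparr>edges := insert {u, v} E\<rparr>) vs"
proof -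
  define \<E> where "\<E> = {E. simple_graph (G\<lparr>edges := E\<rparr>) \<and>
    (\<nexists>vs. hamiltonian_cycle (G\<lparr>edges := E\<rparr>) vs)}"
  have "\<E> \<subseteq> Pow (Pow (verts G))" by (auto simp: \<E>_def simple_graph_def)
  then have "finite \<E>"
    using assms by (auto simp: simple_graph_def intro: finite_subset)
  moreover have "edges G \<in> \<E>" using assms by (simp add: \<E>_def)
  ultimately obtain E where E: "E \<in> \<E>" "edges G \<subseteq> E" "\<forall>E'\<in>\<E>. E \<subseteq> E' \<longrightarrow> E = E'"
    using finite_has_maximal2[of \<E> "edges G"] by blast
  have "\<exists>vs. hamiltonian_cycle (G\<lparr>edges := insert {u, v} E\<rparr>) vs"
    if "u \<in> verts G" "v \<in> verts G" "u \<noteq> v" "{u, v} \<notin> E" for u v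
  proof (rule ccontr)
    assume "\<not> ?thesis"
    then have "insert {u, v} E \<in> \<E>"
      using that E(1) by (auto simp: \<E>_def simple_graph_def)
    then show False using E(3) that(4) by blast
  qed
  then show thesis using that E unfolding \<E>_def by blast
qed

text \<open>Chvatal's degree condition. The last conclusion is what keeps \<open>i\<close> above the minimum
  degree.\<close>

theorem chvatal:
  assumes G: "simple_graph G" and N: "card (verts G) \<ge> 3" and nham: "\<nexists>vs. hamiltonian_cycle G vs"
  obtains i A B u where "2 * i < card (verts G)" "A \<subseteq> B" "B \<subseteq> verts G" "card A = i"
    "card B = card (verts G) - i" "\<And>x. x \<in> A \<Longrightarrow> degree G x \<le> i"
    "\<And>x. x \<in> B \<Longrightarrow> degree G x < card (verts G) - i" "u \<in> verts G" "degree G u \<le> i"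
proof -
  obtain E where E: "edges G \<subseteq> E" "simple_graph (G\<lparr>edges := E\<rparr>)"
    "\<nexists>vs. hamiltonian_cycle (G\<lparr>edges := E\<rparr>) vs"
    "\<And>u v. u \<in> verts G \<Longrightarrow> v \<in> verts G \<Longrightarrow> u \<noteq> v \<Longrightarrow> {u, v} \<notin> E \<Longrightarrow>
       \<exists>vs. hamiltonian_cycle (G\<lparr>edges := insert {u, v} E\<rparr>) vs"
    using maximal_nonhamiltonian[OF G nham] by blast
  define H where "H = G\<lparr>edges := E\<rparr>"
  have H: "simple_graph H" "\<nexists>vs. hamiltonian_cycle H vs" and vH: "verts H = verts G"
    and eH: "edges H = E" using E by (auto simp: H_def)
  have fin: "finite (verts G)" using G by (simp add: simple_graph_def)
  have dle: "degree G x \<le> degree H x" for x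
    unfolding degree_def using E(1) eH finite_nbrs[OF H(1)]
    by (intro card_mono) (auto simp: nbrs_def)
  define P where "P = {(u, v). u \<in> verts G \<and> v \<in> verts G \<and> u \<noteq> v \<and> {u, v} \<notin> E}"
  have finP: "finite P"
    using fin by (intro finite_subset[of P "verts G \<times> verts G"]) (auto simp: P_def)
  have "P \<noteq> {}"
    using hamiltonian_cycle_complete[of H] H(2) N fin vH eH unfolding P_def by auto
  \<comment> \<open>Among all non-adjacent pairs one with the largest degree sum is taken. Since
    \<open>P\<close> is symmetric, the pair can be ordered by degree.\<close>
  then obtain u v where uvP: "(u, v) \<in> P"
    and max: "\<And>x y. (x, y) \<in> P \<Longrightarrow> degree H x + degree H y \<le> degree H u + degree H v"
    and le: "degree H u \<le> degree H v"
  proof -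
    define m where "m = Max ((\<lambda>(x, y). degree H x + degree H y) ` P)"
    have "m \<in> (\<lambda>(x, y). degree H x + degree H y) ` P"
      unfolding m_def using finP \<open>P \<noteq> {}\<close> by (intro Max_in) auto
    then obtain a b where ab: "(a, b) \<in> P" "m = degree H a + degree H b" by auto
    have max: "degree H x + degree H y \<le> m" if "(x, y) \<in> P" for x y
      unfolding m_def using finP that by (intro Max_ge) force+
    have "(b, a) \<in> P" using ab by (auto simp: P_def insert_commute)
    then show thesis
      using that[of a b] that[of b a] ab max by (cases "degree H a \<le> degree H b") (auto simp: add.commute)
  qed
  have uv: "u \<in> verts G" "v \<in> verts G" "u \<noteq> v" "{u, v} \<notin> E" using uvP by (auto simp: P_def)
  then obtain vs where "hamiltonian_cycle (H\<lparr>edges := insert {u, v} (edges H)\<rparr>) vs"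
    using E(4) by (auto simp: H_def)
  then obtain ws where ws: "hamiltonian_path H ws" "length ws = length vs" "hd ws = u" "last ws = v"
    and "length vs \<ge> 3"
    using hamiltonian_path_if_cycle_insert H(2) unfolding hamiltonian_cycle_def by metis
  then obtain A where A: "A \<subseteq> verts G - {v}" "card A = degree H u"
    "\<And>x. x \<in> A \<Longrightarrow> {x, v} \<notin> E" and dsum: "degree H u + degree H v < card (verts G)"
    using degree_sum_less_if_hamiltonian_path[OF H ws(1)] vH eH by metis
  define i where "i = degree H u"
  \<comment> \<open>A vertex of \<open>A\<close> with larger degree than \<open>u\<close> would form
    with \<open>v\<close> a non-adjacent pair of larger degree sum.\<close>
  have degA: "degree H x \<le> i" if "x \<in> A" for x
    using max[of x v] A that uv unfolding P_def i_def by fastforce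
  define B where "B = {x \<in> verts G. degree H x < card (verts G) - i}"
  \<comment> \<open>By the same maximality a non-neighbour of \<open>u\<close> has degree at most
    that of \<open>v\<close>, and \<open>u\<close> itself does by the choice of order. There are
    \<open>card (verts G) - i\<close> such vertices.\<close>
  have "verts G - nbrs H u \<subseteq> B"
  proof
    fix x assume x: "x \<in> verts G - nbrs H u"
    have "degree H x \<le> degree H v"
    proof (cases "x = u")
      case True
      then show ?thesis using le by simp
    next
      case False
      then have "(u, x) \<in> P" using x uv by (auto simp: P_def nbrs_def eH)
      then show ?thesis using max by fastforce
    qed
    then show "x \<in> B" using x dsum by (simp add: B_def i_def)
  qed
  moreover have "card (verts G - nbrs H u) = card (verts G) - i"
    using nbrs_subset[OF H(1), of u] finite_nbrs[OF H(1)] vH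
    by (simp add: card_Diff_subset i_def degree_def subset_Diff_insert)
  moreover have finB: "finite B" using fin by (simp add: B_def)
  ultimately have cB: "card (verts G) - i \<le> card B" by (metis card_mono)
  have "2 * i < card (verts G)" using dsum le by (simp add: i_def)
  then have AB: "A \<subseteq> B" using A degA unfolding B_def by fastforce
  have "card A \<le> card (verts G) - i" using A \<open>2 * i < card (verts G)\<close> i_def by simp
  \<comment> \<open>\<open>B\<close> may be too large; it is thinned out around \<open>A\<close> to
    the exact size that the degree count uses.\<close>
  then obtain B' where B': "A \<subseteq> B'" "B' \<subseteq> B" "card B' = card (verts G) - i"
    using exists_subset_between[OF _ cB AB finB] by blast
  show thesis
  proof (rule that[of i A B' u])
    show "degree G x \<le> i" if "x \<in> A" for x
      using degA[OF that] dle[of x] by simp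
    show "degree G x < card (verts G) - i" if "x \<in> B'" for x
      using that B' dle[of x] unfolding B_def by fastforce
    show "degree G u \<le> i" using dle by (simp add: i_def)
    show "B' \<subseteq> verts G" using B' by (auto simp: B_def)
  qed (use \<open>2 * i < card (verts G)\<close> B' A uv i_def in auto)
qed

section \<open>An obstruction to Hamiltonian cycles\<close>

text \<open>Deleting \<open>D\<close> isolates the \<open>card A\<close> vertices of
  \<open>A\<close> and leaves at least one further vertex, so there are more components than deleted
  vertices. On the cycle this becomes a count: predecessors and successors of \<open>A\<close> all
  lie in \<open>D\<close>, and as \<open>D\<close> is no larger than \<open>A\<close>, the cycle can
  never leave their union.\<close>

lemma no_hamiltonian_cycle_if_tight_set:
  assumes fin: "finite (verts G)" and A: "A \<subseteq> verts G" "A \<noteq> {}" and D: "D \<subseteq> verts G"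
    and AD: "A \<inter> D = {}" "card D = card A" "2 * card A < card (verts G)"
    and E: "\<And>x y. x \<in> A \<Longrightarrow> {x, y} \<in> edges G \<Longrightarrow> y \<in> D"
  shows "\<nexists>vs. hamiltonian_cycle G vs"
proof
  assume "\<exists>vs. hamiltonian_cycle G vs"
  then obtain vs where "hamiltonian_cycle G vs" by blast
  then have vs: "distinct vs" "set vs = verts G"
    and cyc: "\<And>k. k < length vs \<Longrightarrow> {vs ! k, vs ! (Suc k mod length vs)} \<in> edges G"
    by (auto simp: hamiltonian_cycle_def)
  let ?L = "length vs"
  define s where "s k = Suc k mod ?L" for k
  define I where "I X = {k. k < ?L \<and> vs ! k \<in> X}" for X
  have L: "?L = card (verts G)" using vs distinct_card by metis
  have s_less: "s k < ?L" if "k < ?L" for k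
    unfolding s_def using that by (intro mod_less_divisor) linarith
  have inj: "inj_on s {..<?L}"
  proof (rule inj_onI)
    fix x y assume "x \<in> {..<?L}" "y \<in> {..<?L}" "s x = s y"
    then show "x = y"
      unfolding s_def by (cases "Suc x = ?L"; cases "Suc y = ?L") auto
  qed
  have cI: "card (I X) = card X" if "X \<subseteq> verts G" for X
  proof (rule bij_betw_same_card[of "(!) vs"])
    have "(!) vs ` I X = X"
    proof (intro equalityI subsetI)
      fix x assume "x \<in> X"
      then have "x \<in> set vs" using that vs by auto
      then show "x \<in> (!) vs ` I X"
        using \<open>x \<in> X\<close> by (auto simp: I_def in_set_conv_nth)
    qed (auto simp: I_def)
    moreover have "inj_on ((!) vs) (I X)"
      using vs by (auto simp: inj_on_def I_def nth_eq_iff_index_eq)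
    ultimately show "bij_betw ((!) vs) (I X) X" by (simp add: bij_betw_def)
  qed
  have fI: "finite (I X)" and subI: "I X \<subseteq> {..<?L}" for X
    by (auto simp: I_def)
  have csI: "card (s ` I X) = card (I X)" for X
    using inj subI by (intro card_image) (rule inj_on_subset)
  have AtoD: "s ` I A \<subseteq> I D"
  proof
    fix k assume "k \<in> s ` I A"
    then obtain j where "k = s j" "j < ?L" "vs ! j \<in> A" by (auto simp: I_def)
    then show "k \<in> I D" using E cyc[of j] s_less[of j] by (auto simp: I_def s_def)
  qed
  have "I A \<subseteq> s ` I D"
  proof
    fix k assume k: "k \<in> I A"
    have "s ` {..<?L} = {..<?L}"
      using inj s_less by (intro endo_inj_surj) auto
    then have "k \<in> s ` {..<?L}" using k by (simp add: I_def)
    then obtain j where j: "k = s j" "j < ?L" by auto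
    then have "{vs ! k, vs ! j} \<in> edges G"
      using cyc[of j] by (simp add: s_def insert_commute)
    then have "j \<in> I D" using E k j by (auto simp: I_def)
    then show "k \<in> s ` I D" using j by blast
  qed
  \<comment> \<open>Both sides have \<open>card A\<close> elements, so the inclusion is an equality:
    the successor of a position in \<open>D\<close> is always in \<open>A\<close>.\<close>
  then have "s ` I D = I A"
    using csI[of D] cI[of A] cI[of D] A D AD fI by (metis card_subset_eq finite_imageI)
  then have closed: "s k \<in> I A \<union> I D" if "k \<in> I A \<union> I D" for k
    using that AtoD by blast
  obtain a where a: "a \<in> I A"
  proof -
    have "card (I A) > 0"
      using cI[of A] A finite_subset[OF A(1) fin] by (simp add: card_gt_0_iff)
    then show thesis using that by (auto simp: card_gt_0_iff)
  qed
  then have aL: "a < ?L" by (simp add: I_def)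
  have orbit: "(a + m) mod ?L \<in> I A \<union> I D" for m
  proof (induction m)
    case 0
    then show ?case using a aL by simp
  next
    case (Suc m)
    then show ?case using closed[OF Suc] by (simp add: s_def mod_simps)
  qed
  have "{..<?L} \<subseteq> I A \<union> I D"
  proof
    fix j assume "j \<in> {..<?L}"
    then show "j \<in> I A \<union> I D"
      \<comment> \<open>From \<open>a\<close>, a walk of \<open>?L - a + j\<close> steps ends at
        \<open>j\<close> modulo \<open>?L\<close>; the summand \<open>?L\<close> avoids a truncated
        difference when \<open>j < a\<close>.\<close>
      using orbit[of "?L - a + j"] aL by simp
  qed
  then have "?L \<le> card (I A \<union> I D)"
    using fI by (metis card_lessThan card_mono finite_UnI)
  also have "\<dots> \<le> 2 * card A"
    using card_Un_le[of "I A" "I D"] cI A D AD by simp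
  finally show False using AD L by simp
qed

section \<open>The join with a complete graph\<close>

lemma edges_join_complete [simp]:
  "{Inl x, Inl y} \<in> edges (join_complete G t) \<longleftrightarrow> {x, y} \<in> edges G"
  "{Inr k, z} \<in> edges (join_complete G t) \<longleftrightarrow>
     k < t \<and> z \<in> verts (join_complete G t) \<and> z \<noteq> Inr k"
proof -
  have "{Inl x, Inl y} = Inl ` {x, y}" by simp
  then have "{Inl x, Inl y} \<in> (`) Inl ` edges G \<longleftrightarrow> {x, y} \<in> edges G"
    by (metis (no_types, lifting) image_iff inj_Inl inj_image_eq_iff)
  then show "{Inl x, Inl y} \<in> edges (join_complete G t) \<longleftrightarrow> {x, y} \<in> edges G"
    by (auto simp: join_complete_def doubleton_eq_iff)
  have "{Inr k, z} \<notin> (`) Inl ` edges G" by auto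
  then show "{Inr k, z} \<in> edges (join_complete G t) \<longleftrightarrow>
     k < t \<and> z \<in> verts (join_complete G t) \<and> z \<noteq> Inr k"
    by (fastforce simp: join_complete_def doubleton_eq_iff)
qed

lemma verts_join_complete: "verts (join_complete G t) = Inl ` verts G \<union> Inr ` {..<t}"
  by (simp add: join_complete_def)

lemma simple_graph_join_complete:
  assumes "simple_graph G"
  shows "simple_graph (join_complete G t)"
proof -
  have fin: "finite (verts G)" and E: "\<And>e. e \<in> edges G \<Longrightarrow> e \<subseteq> verts G \<and> card e = 2"
    using assms by (auto simp: simple_graph_def)
  have "Inl ` e \<subseteq> verts (join_complete G t) \<and> card (Inl ` e) = 2" if "e \<in> edges G" for e
    using E[OF that] by (auto simp: card_image verts_join_complete)
  then show ?thesis
    using fin unfolding simple_graph_def by (auto simp: join_complete_def)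
qed

lemma card_verts_join_complete:
  "finite (verts G) \<Longrightarrow> card (verts (join_complete G t)) = card (verts G) + t"
  unfolding verts_join_complete
  by (subst card_Un_disjoint) (auto simp: card_image)

lemma degree_join_complete:
  assumes "simple_graph G"
  shows "x \<in> verts G \<Longrightarrow> degree (join_complete G t) (Inl x) = degree G x + t"
    and "k < t \<Longrightarrow> degree (join_complete G t) (Inr k) = card (verts G) + t - 1"
proof -
  assume x: "x \<in> verts G"
  have "nbrs (join_complete G t) (Inl x) = Inl ` nbrs G x \<union> Inr ` {..<t}"
  proof (intro set_eqI)
    fix z :: "'a + nat"
    show "z \<in> nbrs (join_complete G t) (Inl x) \<longleftrightarrow> z \<in> Inl ` nbrs G x \<union> Inr ` {..<t}"
      using x by (cases z) (auto simp: nbrs_def verts_join_complete insert_commute[of "Inl x" "Inr _"])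
  qed
  then show "degree (join_complete G t) (Inl x) = degree G x + t"
    using finite_nbrs[OF assms] unfolding degree_def
    by (simp, subst card_Un_disjoint) (auto simp: card_image)
next
  assume k: "k < t"
  then have "nbrs (join_complete G t) (Inr k) = verts (join_complete G t) - {Inr k}"
    by (auto simp: nbrs_def)
  then show "degree (join_complete G t) (Inr k) = card (verts G) + t - 1"
    using k assms card_verts_join_complete[of G t] unfolding degree_def
    by (simp add: simple_graph_def verts_join_complete)
qed

text \<open>Chvatal's condition pulled back from the join, where each vertex of \<open>G\<close>
  gains degree \<open>t\<close>. The sets avoid the new vertices: one of these has degree
  \<open>n + t - 1\<close>, so its membership in \<open>B\<close> would force \<open>i = 0\<close>,
  against \<open>t \<le> i\<close> and the existence of a new vertex.\<close>

lemma join_nonhamiltonian_degrees: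
  assumes "join_nonhamiltonian n t G" and N: "n + t \<ge> 3"
  obtains i A B where "t \<le> i" "2 * i < n + t" "A \<subseteq> B" "B \<subseteq> verts G" "card A = i"
    "card B = n + t - i" "\<And>x. x \<in> A \<Longrightarrow> degree G x + t \<le> i" "\<And>x. x \<in> B \<Longrightarrow> degree G x + i < n"
proof -
  let ?J = "join_complete G t"
  have G: "simple_graph G" "card (verts G) = n" "\<nexists>vs. hamiltonian_cycle ?J vs"
    using assms by (auto simp: join_nonhamiltonian_def)
  have J: "simple_graph ?J" "card (verts ?J) = n + t"
    using G simple_graph_join_complete[OF G(1)] card_verts_join_complete[of G t]
    by (simp_all add: simple_graph_def[of G])
  obtain i A B u where i: "2 * i < n + t" and AB: "A \<subseteq> B" "B \<subseteq> verts ?J" "card A = i"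
    "card B = n + t - i" "\<And>x. x \<in> A \<Longrightarrow> degree ?J x \<le> i"
    "\<And>x. x \<in> B \<Longrightarrow> degree ?J x < n + t - i" and u: "u \<in> verts ?J" "degree ?J u \<le> i"
    using chvatal[OF J(1) _ G(3)] J(2) N by metis
  have ti: "t \<le> i"
  proof (cases u)
    case (Inl x)
    then show ?thesis using u degree_join_complete(1)[OF G(1), of x t] by (auto simp: verts_join_complete)
  next
    case (Inr k)
    then have "n + t - 1 \<le> i" using u degree_join_complete(2)[OF G(1), of k t] G(2)
      by (auto simp: verts_join_complete)
    then show ?thesis using i N by linarith
  qed
  have "z \<in> Inl ` verts G" if z: "z \<in> B" for z
  proof (cases z)
    case (Inl x)
    then show ?thesis using AB(2) z by (auto simp: verts_join_complete)
  next
    case (Inr k)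
    then have k: "k < t" using AB(2) z by (auto simp: verts_join_complete)
    then have "n + t - 1 < n + t - i"
      using AB(6)[OF z] degree_join_complete(2)[OF G(1) k] G(2) Inr by simp
    then show ?thesis using k ti by linarith
  qed
  then obtain B' where B': "B = Inl ` B'" "B' \<subseteq> verts G" by (metis subsetI subset_imageE)
  then obtain A' where A': "A = Inl ` A'" "A' \<subseteq> B'" using AB(1) by (metis subset_imageE)
  show thesis
  proof (rule that[of i A' B'])
    show "degree G x + t \<le> i" if "x \<in> A'" for x
      using AB(5)[of "Inl x"] degree_join_complete(1)[OF G(1), of x t] that A' B' by auto
    show "degree G x + i < n" if "x \<in> B'" for x
      using AB(6)[of "Inl x"] degree_join_complete(1)[OF G(1), of x t] that A' B' by auto
    show "card A' = i" "card B' = n + t - i"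
      using AB A' B' by (auto simp: card_image)
  qed (use ti i A' B' in auto)
qed

section \<open>Extremal graphs and their edge counts\<close>

text \<open>The extremal graphs: \<open>A\<close> is independent, \<open>B - A\<close> is a clique, there are no edges between
  these two sets, and the remaining \<open>i - t\<close> vertices are joined to everything.\<close>

definition split_sets :: "nat \<Rightarrow> nat \<Rightarrow> 'a ugraph \<Rightarrow> 'a set \<Rightarrow> 'a set \<Rightarrow> bool" where
  "split_sets t i G A B \<longleftrightarrow> A \<subseteq> B \<and> B \<subseteq> verts G \<and> card A = i \<and> card B = card (verts G) + t - i \<and>
     (\<forall>x y. {x, y} \<in> edges G \<longleftrightarrow>
        x \<in> verts G \<and> y \<in> verts G \<and> x \<noteq> y \<and> (x \<in> A \<longrightarrow> y \<notin> B) \<and> (y \<in> A \<longrightarrow> x \<notin> B))"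

text \<open>The two inequalities make the sizes realisable: \<open>t \<le> i\<close> lets
  \<open>B\<close> fit into the vertex set, and \<open>2 * i < card (verts G) + t\<close> lets
  \<open>A\<close> be strictly smaller than \<open>B\<close>.\<close>

definition split_like :: "nat \<Rightarrow> nat \<Rightarrow> 'a ugraph \<Rightarrow> bool" where
  "split_like t i G \<longleftrightarrow> simple_graph G \<and> t \<le> i \<and> 2 * i < card (verts G) + t \<and>
     (\<exists>A B. split_sets t i G A B)"

lemma split_setsD:
  assumes "split_sets t i G A B"
  shows "A \<subseteq> B" "B \<subseteq> verts G" "card A = i" "card B = card (verts G) + t - i"
    and "\<And>x y. {x, y} \<in> edges G \<longleftrightarrow>
      x \<in> verts G \<and> y \<in> verts G \<and> x \<noteq> y \<and> (x \<in> A \<longrightarrow> y \<notin> B) \<and> (y \<in> A \<longrightarrow> x \<notin> B)"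
  using assms unfolding split_sets_def by simp_all

text \<open>Twice the number of non-edges of a \<open>split_like t i\<close> graph on \<open>N - t\<close> vertices; it does not
  depend on \<open>t\<close>.\<close>

definition missing :: "nat \<Rightarrow> nat \<Rightarrow> int" where
  "missing N i = int i * (2 * int N - 3 * int i - 1)"

lemma sum_three_levels:
  fixes a b c :: int
  assumes "finite V" "A \<subseteq> B" "B \<subseteq> V"
  shows "(\<Sum>x\<in>V. if x \<in> A then a else if x \<in> B then b else c) =
    int (card A) * a + (int (card B) - int (card A)) * b + (int (card V) - int (card B)) * c"
proof -
  have fin: "finite B" using assms(3,1) by (rule finite_subset)
  let ?f = "\<lambda>x. if x \<in> A then a else if x \<in> B then b else c"
  have "sum ?f V = sum ?f (V - B) + (sum ?f (B - A) + sum ?f A)"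
    using sum.subset_diff[OF assms(3,1), of ?f] sum.subset_diff[OF assms(2) fin, of ?f] by simp
  also have "sum ?f (V - B) = (\<Sum>x\<in>V - B. c)"
    using assms by (intro sum.cong) auto
  also have "sum ?f (B - A) = (\<Sum>x\<in>B - A. b)"
    by (intro sum.cong) auto
  also have "sum ?f A = (\<Sum>x\<in>A. a)"
    by (intro sum.cong) auto
  finally show ?thesis
    using assms fin finite_subset[OF assms(2) fin] by (simp add: card_Diff_subset card_mono of_nat_diff)
qed

text \<open>The three values are the degree ceilings on \<open>A\<close>, on \<open>B - A\<close>
  and outside \<open>B\<close>. They serve twice: as upper bounds for an arbitrary non-Hamiltonian
  join and as the exact degrees of an extremal graph.\<close>

lemma sum_three_levels_missing:
  assumes "finite V" "A \<subseteq> B" "B \<subseteq> V" "card A = i" "card B = card V + t - i" "2 * i < card V + t"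
  shows "(\<Sum>x\<in>V. if x \<in> A then int i - int t else if x \<in> B then int (card V) - 1 - int i
      else int (card V) - 1) = int (card V) * (int (card V) - 1) - missing (card V + t) i"
proof -
  have cB: "int (card B) = int (card V) + int t - int i" using assms by simp
  show ?thesis
    unfolding sum_three_levels[OF assms(1-3)] cB assms(4)
    by (simp add: missing_def algebra_simps)
qed

lemma join_nonhamiltonian_edges:
  assumes nh: "join_nonhamiltonian n t G" and N: "n + t \<ge> 3"
  obtains i where "t \<le> i" "2 * i < n + t"
    "2 * int (card (edges G)) \<le> int n * (int n - 1) - missing (n + t) i"
    "2 * int (card (edges G)) = int n * (int n - 1) - missing (n + t) i \<Longrightarrow> split_like t i G"
proof -
  have G: "simple_graph G" "card (verts G) = n" and fin: "finite (verts G)"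
    using nh by (auto simp: join_nonhamiltonian_def simple_graph_def)
  obtain i A B where i: "t \<le> i" "2 * i < n + t" and AB: "A \<subseteq> B" "B \<subseteq> verts G" "card A = i"
    "card B = n + t - i" and dA: "\<And>x. x \<in> A \<Longrightarrow> degree G x + t \<le> i"
    and dB: "\<And>x. x \<in> B \<Longrightarrow> degree G x + i < n"
    using join_nonhamiltonian_degrees[OF nh N] by metis
  define w where "w x = (if x \<in> A then int i - int t else if x \<in> B then int n - 1 - int i
      else int n - 1)" for x
  have sumw: "sum w (verts G) = int n * (int n - 1) - missing (n + t) i"
    unfolding w_def using sum_three_levels_missing[OF fin AB(1-3), of t] AB i unfolding G(2) by simp
  have sumd: "(\<Sum>x\<in>verts G. int (degree G x)) = 2 * int (card (edges G))"
    using sum_degree[OF G(1)] by (metis of_nat_mult of_nat_numeral of_nat_sum)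
  have le: "int (degree G x) \<le> w x" if x: "x \<in> verts G" for x
  proof -
    have "degree G x \<le> card (verts G - {x})"
      unfolding degree_def using nbrs_subset[OF G(1)] fin by (intro card_mono) auto
    then have "degree G x \<le> n - 1" "n > 0" using G fin x by (auto simp: card_gt_0_iff)
    then show ?thesis unfolding w_def using dA[of x] dB[of x] by auto
  qed
  show thesis
  proof (rule that[OF i])
    show "2 * int (card (edges G)) \<le> int n * (int n - 1) - missing (n + t) i"
      using sum_mono[of "verts G" "\<lambda>x. int (degree G x)" w] le sumw sumd by simp
  next
    assume eq: "2 * int (card (edges G)) = int n * (int n - 1) - missing (n + t) i"
    have deq: "int (degree G x) = w x" if "x \<in> verts G" for x
      using sum_mono_inv[of "\<lambda>x. int (degree G x)" "verts G" w, OF _ le that fin] sumw sumd eq by simp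
    have finB: "finite B" using AB(2) fin by (rule finite_subset)
    have finA: "finite A" using AB(1) finB by (rule finite_subset)
    \<comment> \<open>Equality in the sum makes every degree reach its ceiling, and the structure
      then follows from the outside in. Vertices outside \<open>B\<close> dominate; they already
      supply the \<open>i - t\<close> neighbours of each vertex of \<open>A\<close>, so
      \<open>A\<close> has none in \<open>B\<close>; a vertex of \<open>B - A\<close> thus misses
      \<open>A\<close>, and its degree leaves no other non-neighbour.\<close>
    have nbD: "nbrs G x = verts G - {x}" if "x \<in> verts G" "x \<notin> B" for x
    proof (rule card_subset_eq)
      have "x \<notin> A" "card (verts G) > 0" using that AB fin by (auto simp: card_gt_0_iff)
      then show "card (nbrs G x) = card (verts G - {x})"
        using deq[OF that(1)] that G unfolding w_def degree_def by simp
    qed (use fin nbrs_subset[OF G(1)] in auto)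
    have nbA: "nbrs G x = verts G - B" if "x \<in> A" for x
    proof (rule sym, rule card_subset_eq)
      have "x \<in> B" using that AB by auto
      have "y \<in> nbrs G x" if "y \<in> verts G - B" for y
        using nbD[of y] that \<open>x \<in> B\<close> AB by (auto simp: nbrs_def insert_commute)
      then show "verts G - B \<subseteq> nbrs G x" by blast
      show "card (verts G - B) = card (nbrs G x)"
        using deq[of x] that \<open>x \<in> B\<close> AB(2,4) G finB i unfolding w_def degree_def
        by (simp add: card_Diff_subset subset_iff)
    qed (use finite_nbrs[OF G(1)] in auto)
    have nbC: "nbrs G x = verts G - A - {x}" if "x \<in> B - A" for x
    proof (rule card_subset_eq)
      have xV: "x \<in> verts G - A" using that AB by auto
      have "y \<notin> A" if "y \<in> nbrs G x" for y
        using nbA[of y] that \<open>x \<in> B - A\<close> by (auto simp: nbrs_def insert_commute)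
      then show "nbrs G x \<subseteq> verts G - A - {x}" using nbrs_subset[OF G(1), of x] by blast
      have "card (verts G - A - {x}) = n - i - 1"
        using xV AB G fin finA by (simp add: card_Diff_subset)
      then show "card (nbrs G x) = card (verts G - A - {x})"
        using deq[of x] xV that unfolding w_def degree_def by simp
    qed (use fin in auto)
    have "{x, y} \<in> edges G \<longleftrightarrow> x \<in> verts G \<and> y \<in> verts G \<and> x \<noteq> y \<and>
        (x \<in> A \<longrightarrow> y \<notin> B) \<and> (y \<in> A \<longrightarrow> x \<notin> B)" for x y
    proof (cases "x \<in> verts G")
      case False
      then show ?thesis using simple_graph_edgeD[OF G(1)] by blast
    next
      case True
      have "{x, y} \<in> edges G \<longleftrightarrow> y \<in> nbrs G x" by (simp add: nbrs_def)
      also have "\<dots> \<longleftrightarrow> x \<in> verts G \<and> y \<in> verts G \<and> x \<noteq> y \<and>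
          (x \<in> A \<longrightarrow> y \<notin> B) \<and> (y \<in> A \<longrightarrow> x \<notin> B)"
        using True nbA[of x] nbC[of x] nbD[of x] AB by auto
      finally show ?thesis .
    qed
    then have "split_sets t i G A B" unfolding split_sets_def using G AB by blast
    then show "split_like t i G" unfolding split_like_def using G i by blast
  qed
qed

lemma split_like_card_edges:
  assumes "split_like t i G"
  shows "2 * int (card (edges G)) =
    int (card (verts G)) * (int (card (verts G)) - 1) - missing (card (verts G) + t) i"
proof -
  have G: "simple_graph G" and i: "t \<le> i" "2 * i < card (verts G) + t"
    using assms by (auto simp: split_like_def)
  obtain A B where "split_sets t i G A B" using assms by (auto simp: split_like_def)
  note AB = split_setsD(1-4)[OF this] and E = split_setsD(5)[OF this]
  have fin: "finite (verts G)" using G by (simp add: simple_graph_def)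
  have finB: "finite B" using AB(2) fin by (rule finite_subset)
  have finA: "finite A" using AB(1) finB by (rule finite_subset)
  have "int (degree G x) = (if x \<in> A then int i - int t else if x \<in> B then
      int (card (verts G)) - 1 - int i else int (card (verts G)) - 1)" if x: "x \<in> verts G" for x
  proof -
    have pos: "card (verts G) > 0" using x fin by (auto simp: card_gt_0_iff)
    consider "x \<in> A" | "x \<in> B" "x \<notin> A" | "x \<notin> B" by blast
    then show ?thesis
    proof cases
      case 1
      then have "nbrs G x = verts G - B" using AB by (auto simp: nbrs_def E)
      then show ?thesis using 1 AB finB fin i card_mono[OF fin AB(2)]
        by (simp add: degree_def card_Diff_subset)
    next
      case 2
      then have "nbrs G x = verts G - A - {x}" using AB by (auto simp: nbrs_def E)
      moreover have "x \<in> verts G - A" using x 2 by simp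
      moreover have "card A < card (verts G)"
        using AB fin 2 by (intro psubset_card_mono) auto
      ultimately show ?thesis using 2 AB finA
        by (simp add: degree_def card_Diff_subset)
    next
      case 3
      then have "nbrs G x = verts G - {x}" "x \<notin> A" using AB x by (auto simp: nbrs_def E)
      then show ?thesis using 3 x pos by (simp add: degree_def)
    qed
  qed
  then have "(\<Sum>x\<in>verts G. int (degree G x)) =
      int (card (verts G)) * (int (card (verts G)) - 1) - missing (card (verts G) + t) i"
    using sum_three_levels_missing[OF fin AB(1-3), of t] AB i by simp
  moreover have "(\<Sum>x\<in>verts G. int (degree G x)) = 2 * int (card (edges G))"
    using sum_degree[OF G(1)] by (metis of_nat_mult of_nat_numeral of_nat_sum)
  ultimately show ?thesis by simp
qed

text \<open>The tight set is \<open>A\<close>, and its neighbours lie among the \<open>t\<close> new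
  vertices and the \<open>i - t\<close> dominating ones, \<open>i\<close> in total. The case
  \<open>i = 0\<close> must be excluded because the graph is then complete.\<close>

lemma split_like_join_nonhamiltonian:
  assumes "split_like t i G" "i \<ge> 1"
  shows "join_nonhamiltonian (card (verts G)) t G"
proof -
  let ?J = "join_complete G t"
  have G: "simple_graph G" and i: "t \<le> i" "2 * i < card (verts G) + t"
    using assms(1) by (auto simp: split_like_def)
  obtain A B where "split_sets t i G A B" using assms(1) by (auto simp: split_like_def)
  note AB = split_setsD(1-4)[OF this] and E = split_setsD(5)[OF this]
  have J: "simple_graph ?J" using simple_graph_join_complete[OF G] .
  have fin: "finite (verts G)" using G by (simp add: simple_graph_def)
  have finB: "finite B" using AB(2) fin by (rule finite_subset)
  have cJ: "card (verts ?J) = card (verts G) + t" using card_verts_join_complete[OF fin] .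
  have BJ: "Inl ` B \<subseteq> verts ?J" using AB by (auto simp: verts_join_complete)
  have "\<nexists>vs. hamiltonian_cycle ?J vs"
  proof (rule no_hamiltonian_cycle_if_tight_set[of _ "Inl ` A" "verts ?J - Inl ` B"])
    show "finite (verts ?J)" using J by (simp add: simple_graph_def)
    show "Inl ` A \<subseteq> verts ?J" using AB BJ by auto
    show "Inl ` A \<noteq> ({} :: ('a + nat) set)" using AB assms(2) by auto
    show "Inl ` A \<inter> (verts ?J - Inl ` B) = {}" using AB by auto
    have "card (verts ?J - Inl ` B) = card (verts ?J) - card B"
      using BJ finB by (simp add: card_Diff_subset card_image)
    then show "card (verts ?J - Inl ` B) = card (Inl ` A :: ('a + nat) set)"
      using AB cJ i by (simp add: card_image)
    show "2 * card (Inl ` A :: ('a + nat) set) < card (verts ?J)"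
      using AB cJ i by (simp add: card_image)
    fix x y assume x: "x \<in> Inl ` A" and xy: "{x, y} \<in> edges ?J"
    then show "y \<in> verts ?J - Inl ` B"
      using simple_graph_edgeD(2)[OF J xy] E by auto
  qed auto
  then show ?thesis using G by (simp add: join_nonhamiltonian_def)
qed

text \<open>Adjacency depends only on which of the three blocks \<open>A\<close>,
  \<open>B - A\<close> and the complement of \<open>B\<close> contain the two vertices, and the
  block sizes are fixed. Any three bijections between corresponding blocks therefore glue to an
  isomorphism.\<close>

lemma split_like_iso:
  assumes "split_like t i G" "split_like t i H" "card (verts G) = card (verts H)"
  shows "graph_iso G H"
proof -
  have G: "simple_graph G"
    using assms(1) by (auto simp: split_like_def)
  obtain A B where "split_sets t i G A B" using assms(1) by (auto simp: split_like_def)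
  note AB = split_setsD(1-4)[OF this] and E = split_setsD(5)[OF this]
  have H: "simple_graph H"
    using assms(2) by (auto simp: split_like_def)
  obtain A' B' where "split_sets t i H A' B'" using assms(2) by (auto simp: split_like_def)
  note AB' = split_setsD(1-4)[OF this] and E' = split_setsD(5)[OF this]
  have fin: "finite (verts G)" "finite (verts H)" using G H by (auto simp: simple_graph_def)
  then have fin': "finite A" "finite B" "finite A'" "finite B'"
    using AB(1,2) AB'(1,2) by (meson finite_subset)+
  obtain f where f: "bij_betw f A A'"
    using finite_same_card_bij[of A A'] fin' AB AB' by auto
  obtain g where g: "bij_betw g (B - A) (B' - A')"
    using finite_same_card_bij[of "B - A" "B' - A'"] fin' AB AB' assms(3)
    by (auto simp: card_Diff_subset)
  obtain h where h: "bij_betw h (verts G - B) (verts H - B')"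
    using finite_same_card_bij[of "verts G - B" "verts H - B'"] fin fin' AB AB' assms(3)
    by (auto simp: card_Diff_subset)
  define k where "k x = (if x \<in> A then f x else if x \<in> B then g x else h x)" for x
  have kA: "bij_betw k A A'"
    using f by (rule bij_betw_cong[THEN iffD1, rotated]) (simp add: k_def)
  have kBA: "bij_betw k (B - A) (B' - A')"
    using g by (rule bij_betw_cong[THEN iffD1, rotated]) (simp add: k_def)
  have kVB: "bij_betw k (verts G - B) (verts H - B')"
    using h by (rule bij_betw_cong[THEN iffD1, rotated]) (use AB in \<open>auto simp: k_def\<close>)
  have "bij_betw k (A \<union> (B - A)) (A' \<union> (B' - A'))"
    using bij_betw_combine[OF kA kBA] by blast
  then have kB: "bij_betw k B B'" using AB AB' by (simp add: Un_absorb1)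
  have "bij_betw k (B \<union> (verts G - B)) (B' \<union> (verts H - B'))"
    using bij_betw_combine[OF kB kVB] by blast
  then have k: "bij_betw k (verts G) (verts H)" using AB AB' by (simp add: Un_absorb1)
  have "k x \<in> A' \<longleftrightarrow> x \<in> A" "k x \<in> B' \<longleftrightarrow> x \<in> B" "k x \<in> verts H" if "x \<in> verts G" for x
    using that kA kBA kVB k AB AB' unfolding bij_betw_def by blast+
  moreover have "k x = k y \<longleftrightarrow> x = y" if "x \<in> verts G" "y \<in> verts G" for x y
    using that k by (auto simp: bij_betw_def inj_on_def)
  ultimately show ?thesis
    unfolding graph_iso_def using k E E' by (intro exI[of _ k]) simp
qed

lemma split_like_exists:
  assumes "t \<le> i" "2 * i < n + t"
  shows "\<exists>G :: nat ugraph. split_like t i G \<and> card (verts G) = n"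
proof -
  define B where "B = {..<n + t - i}"
  define G where "G = \<lparr>verts = {..<n}, edges = {{x, y} | x y. x < n \<and> y < n \<and> x \<noteq> y \<and>
    (x < i \<longrightarrow> y \<notin> B) \<and> (y < i \<longrightarrow> x \<notin> B)}\<rparr>"
  have E: "{x, y} \<in> edges G \<longleftrightarrow> x \<in> verts G \<and> y \<in> verts G \<and> x \<noteq> y \<and>
      (x \<in> {..<i} \<longrightarrow> y \<notin> B) \<and> (y \<in> {..<i} \<longrightarrow> x \<notin> B)" for x y
    by (auto simp: G_def doubleton_eq_iff)
  have "split_sets t i G {..<i} B"
    unfolding split_sets_def
    by (intro conjI allI E) (use assms in \<open>auto simp: G_def B_def\<close>)
  moreover have "simple_graph G" by (auto simp: simple_graph_def G_def)
  ultimately have "split_like t i G"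
    using assms unfolding split_like_def by (auto simp: G_def)
  moreover have "card (verts G) = n" by (simp add: G_def)
  ultimately show ?thesis by blast
qed

text \<open>Isolated vertices distinguish the two: for \<open>i = t\<close> no vertex dominates and
  those of \<open>A\<close> are isolated, whereas for \<open>i > t\<close> a dominating vertex
  exists and rules out isolated ones.\<close>

lemma split_like_not_iso:
  assumes G: "split_like t t G" and H: "split_like t i H" and "1 \<le> t" "t < i"
    "card (verts H) \<ge> 2"
  shows "\<not> graph_iso G H"
proof
  assume "graph_iso G H"
  then obtain f where f: "bij_betw f (verts G) (verts H)"
    "\<And>x y. x \<in> verts G \<Longrightarrow> y \<in> verts G \<Longrightarrow> {x, y} \<in> edges G \<longleftrightarrow> {f x, f y} \<in> edges H"
    unfolding graph_iso_def by blast
  have sG: "simple_graph G"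
    using G by (auto simp: split_like_def)
  obtain A B where "split_sets t t G A B" using G by (auto simp: split_like_def)
  note AB = split_setsD(1-4)[OF this] and E = split_setsD(5)[OF this]
  have "B = verts G" using AB sG by (intro card_subset_eq) (auto simp: simple_graph_def)
  moreover obtain a where "a \<in> A" using AB assms(3) by (metis card.empty ex_in_conv not_one_le_zero)
  ultimately have a: "a \<in> verts G" "\<And>y. {a, y} \<notin> edges G" using AB E by auto
  have iso: "{f a, z} \<notin> edges H" if "z \<in> verts H" for z
    using f a that by (metis bij_betw_imp_surj_on imageE)
  obtain A' B' where "split_sets t i H A' B'" using H by (auto simp: split_like_def)
  note AB' = split_setsD(1-4)[OF this] and E' = split_setsD(5)[OF this]
  have "card B' < card (verts H)" using AB' assms by linarith
  then obtain d where d: "d \<in> verts H" "d \<notin> B'"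
    using AB' by (metis order_less_irrefl subsetI subset_antisym)
  have fa: "f a \<in> verts H" using f a by (auto simp: bij_betw_def)
  have "d = f a" using iso[OF d(1)] d fa E' AB' by blast
  moreover have "\<not> verts H \<subseteq> {f a}"
    using assms(5) card_mono[of "{f a}" "verts H"] by auto
  then obtain y where "y \<in> verts H" "y \<noteq> f a" by blast
  ultimately show False using iso[of y] d E' AB' by blast
qed

section \<open>Isomorphism as an equivalence relation\<close>

lemma graph_iso_refl: "graph_iso G G"
  unfolding graph_iso_def by (intro exI[of _ id]) auto

lemma graph_iso_trans: "graph_iso G H \<Longrightarrow> graph_iso H K \<Longrightarrow> graph_iso G K"
  unfolding graph_iso_def
proof (elim exE conjE)
  fix f g
  assume f: "bij_betw f (verts G) (verts H)" and g: "bij_betw g (verts H) (verts K)"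
    and fE: "\<forall>x\<in>verts G. \<forall>y\<in>verts G. {x, y} \<in> edges G \<longleftrightarrow> {f x, f y} \<in> edges H"
    and gE: "\<forall>x\<in>verts H. \<forall>y\<in>verts H. {x, y} \<in> edges H \<longleftrightarrow> {g x, g y} \<in> edges K"
  have "bij_betw (g \<circ> f) (verts G) (verts K)" using f g by (rule bij_betw_trans)
  moreover have "{x, y} \<in> edges G \<longleftrightarrow> {(g \<circ> f) x, (g \<circ> f) y} \<in> edges K"
    if "x \<in> verts G" "y \<in> verts G" for x y
    using that fE gE bij_betwE[OF f] by simp
  ultimately show "\<exists>f. bij_betw f (verts G) (verts K) \<and>
      (\<forall>x\<in>verts G. \<forall>y\<in>verts G. {x, y} \<in> edges G \<longleftrightarrow> {f x, f y} \<in> edges K)" by blast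
qed

lemma graph_iso_sym: "graph_iso G H \<Longrightarrow> graph_iso H G"
  unfolding graph_iso_def
proof (elim exE conjE)
  fix f
  assume f: "bij_betw f (verts G) (verts H)"
    and fE: "\<forall>x\<in>verts G. \<forall>y\<in>verts G. {x, y} \<in> edges G \<longleftrightarrow> {f x, f y} \<in> edges H"
  let ?g = "inv_into (verts G) f"
  have g: "bij_betw ?g (verts H) (verts G)" using f by (rule bij_betw_inv_into)
  have "{x, y} \<in> edges H \<longleftrightarrow> {?g x, ?g y} \<in> edges G" if "x \<in> verts H" "y \<in> verts H" for x y
    using that fE bij_betwE[OF g] bij_betw_inv_into_right[OF f] by simp
  then show "\<exists>f. bij_betw f (verts H) (verts G) \<and>
      (\<forall>x\<in>verts H. \<forall>y\<in>verts H. {x, y} \<in> edges H \<longleftrightarrow> {f x, f y} \<in> edges G)" using g by blast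
qed

lemma equiv_graph_iso: "equiv UNIV {(G :: 'a ugraph, H). graph_iso G H}"
  by (intro equivI)
    (auto simp: refl_on_def sym_def trans_def intro: graph_iso_refl graph_iso_sym graph_iso_trans)

section \<open>Minimising the number of non-edges\<close>

text \<open>In the next two lemmas \<open>N = n + t = 2 * m + 1 + p\<close>, so that \<open>m\<close> is the largest \<open>i\<close> with
  \<open>2 * i < N\<close>. As \<open>missing N\<close> is strictly concave, its minimum over \<open>t \<le> i \<le> m\<close> is attained only
  at the ends.\<close>

lemma missing_ge_left:
  assumes "t \<le> i" "i \<le> m" "3 * t \<le> m + 1 + 2 * p"
  shows "missing (2 * m + 1 + p) t \<le> missing (2 * m + 1 + p) i"
    and "missing (2 * m + 1 + p) t = missing (2 * m + 1 + p) i \<longleftrightarrow>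
      i = t \<or> i = m \<and> 3 * t = m + 1 + 2 * p"
proof -
  \<comment> \<open>The difference of two values of a quadratic in \<open>i\<close> contains the
    factor \<open>i - t\<close>; \<open>?d\<close> is the cofactor. Adding the bounds
    \<open>3 * i \<le> 3 * m\<close> and \<open>3 * t \<le> m + 1 + 2 * p\<close> gives
    \<open>?d \<ge> 0\<close>, with equality only if both are tight.\<close>
  let ?d = "4 * int m + 1 + 2 * int p - 3 * int i - 3 * int t"
  have eq: "missing (2 * m + 1 + p) i - missing (2 * m + 1 + p) t = (int i - int t) * ?d"
    by (simp add: missing_def algebra_simps)
  have "?d \<ge> 0" using assms by linarith
  then have "(int i - int t) * ?d \<ge> 0" using assms by (intro mult_nonneg_nonneg) auto
  then show "missing (2 * m + 1 + p) t \<le> missing (2 * m + 1 + p) i" using eq by linarith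
  have "missing (2 * m + 1 + p) t = missing (2 * m + 1 + p) i \<longleftrightarrow> (int i - int t) * ?d = 0"
    using eq by linarith
  also have "\<dots> \<longleftrightarrow> int i - int t = 0 \<or> ?d = 0" by (rule mult_eq_0_iff)
  also have "?d = 0 \<longleftrightarrow> i = m \<and> 3 * t = m + 1 + 2 * p"
    using assms by (intro iffI conjI; linarith)
  also have "int i - int t = 0 \<longleftrightarrow> i = t" by simp
  finally show "missing (2 * m + 1 + p) t = missing (2 * m + 1 + p) i \<longleftrightarrow>
      i = t \<or> i = m \<and> 3 * t = m + 1 + 2 * p" .
qed

lemma missing_ge_right:
  assumes "t \<le> i" "i \<le> m" "3 * t \<ge> m + 1 + 2 * p"
  shows "missing (2 * m + 1 + p) m \<le> missing (2 * m + 1 + p) i"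
    and "missing (2 * m + 1 + p) m = missing (2 * m + 1 + p) i \<longleftrightarrow>
      i = m \<or> i = t \<and> 3 * t = m + 1 + 2 * p"
proof -
  \<comment> \<open>This is the cofactor of \<open>m - i\<close>. It increases with
    \<open>i\<close>, so it is nonnegative because it is so at \<open>i = t\<close>.\<close>
  let ?d = "3 * int i - int m - 1 - 2 * int p"
  have eq: "missing (2 * m + 1 + p) i - missing (2 * m + 1 + p) m = (int m - int i) * ?d"
    by (simp add: missing_def algebra_simps)
  have "?d \<ge> 0" using assms by linarith
  then have "(int m - int i) * ?d \<ge> 0" using assms by (intro mult_nonneg_nonneg) auto
  then show "missing (2 * m + 1 + p) m \<le> missing (2 * m + 1 + p) i" using eq by linarith
  have "missing (2 * m + 1 + p) m = missing (2 * m + 1 + p) i \<longleftrightarrow> (int m - int i) * ?d = 0"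
    using eq by linarith
  also have "\<dots> \<longleftrightarrow> int m - int i = 0 \<or> ?d = 0" by (rule mult_eq_0_iff)
  also have "?d = 0 \<longleftrightarrow> i = t \<and> 3 * t = m + 1 + 2 * p"
    using assms by (intro iffI conjI; linarith)
  also have "int m - int i = 0 \<longleftrightarrow> i = m" by auto
  finally show "missing (2 * m + 1 + p) m = missing (2 * m + 1 + p) i \<longleftrightarrow>
      i = m \<or> i = t \<and> 3 * t = m + 1 + 2 * p" .
qed

section \<open>Closed forms of the bounds and the threshold\<close>

lemma two_int_choose_two: "2 * int (n choose 2) = int n * (int n - 1)"
proof -
  have "even (n * (n - 1))" by (cases n) auto
  then have "2 * (n choose 2) = n * (n - 1)" unfolding choose_two by (rule dvd_mult_div_cancel)
  then have "2 * int (n choose 2) = int (n * (n - 1))" by (metis of_nat_mult of_nat_numeral)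
  then show ?thesis by (cases n) (auto simp: algebra_simps)
qed

lemma missing_left:
  "2 * (int t * (int n - 1) - int (t choose 2)) = missing (n + t) t"
  using two_int_choose_two[of t] by (simp add: missing_def algebra_simps)

text \<open>Here \<open>missing (n + t) m\<close> equals
  \<open>m * (m + 3) = (m + 2) * (m + 1) - 2\<close>, which is where the \<open>- 1\<close> of the
  even case comes from; in the odd case the value \<open>m * (m + 1)\<close> needs no
  correction.\<close>

lemma missing_right_even:
  "n + t = 2 * m + 2 \<Longrightarrow> 2 * (int ((n + t + 2) div 2 choose 2) - 1) = missing (n + t) m"
  using two_int_choose_two[of "m + 2"] by (simp add: missing_def algebra_simps)

lemma missing_right_odd:
  "n + t = 2 * m + 1 \<Longrightarrow> 2 * int ((n + t + 1) div 2 choose 2) = missing (n + t) m"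
  using two_int_choose_two[of "m + 1"] by (simp add: missing_def algebra_simps)

lemma card_edges_le_choose:
  assumes "simple_graph G"
  shows "card (edges G) \<le> card (verts G) choose 2"
proof -
  have "card (edges G) \<le> card {e. e \<subseteq> verts G \<and> card e = 2}"
    using assms by (intro card_mono) (auto simp: simple_graph_def)
  then show ?thesis using assms by (simp add: n_subsets simple_graph_def)
qed

lemma join_nonhamiltonian_edges_le:
  assumes nh: "join_nonhamiltonian n t G" and N: "n + t \<ge> 3" and m: "n + t = 2 * m + 1 + p" "p \<le> 1"
  shows "3 * t \<le> m + 1 + 2 * p \<Longrightarrow>
      2 * int (card (edges G)) \<le> int n * (int n - 1) - missing (n + t) t"
    and "m + 1 + 2 * p \<le> 3 * t \<Longrightarrow>
      2 * int (card (edges G)) \<le> int n * (int n - 1) - missing (n + t) m"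
proof -
  obtain i where i: "t \<le> i" "2 * i < n + t"
    "2 * int (card (edges G)) \<le> int n * (int n - 1) - missing (n + t) i"
    using join_nonhamiltonian_edges[OF nh N] by blast
  have "i \<le> m" using i m by linarith
  then show "3 * t \<le> m + 1 + 2 * p \<Longrightarrow>
      2 * int (card (edges G)) \<le> int n * (int n - 1) - missing (n + t) t"
    and "m + 1 + 2 * p \<le> 3 * t \<Longrightarrow>
      2 * int (card (edges G)) \<le> int n * (int n - 1) - missing (n + t) m"
    using missing_ge_left(1)[of t i m p] missing_ge_right(1)[of t i m p] i m by simp_all
qed

lemma threshold_iff:
  "real t \<le> (real n + 4) / 5 \<longleftrightarrow> 5 * t \<le> n + 4" "(real n + 4) / 5 \<le> real t \<longleftrightarrow> n + 4 \<le> 5 * t"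
  "real t \<le> (real n + 1) / 5 \<longleftrightarrow> 5 * t \<le> n + 1" "(real n + 1) / 5 \<le> real t \<longleftrightarrow> n + 1 \<le> 5 * t"
  "real t = (real n + 4) / 5 \<longleftrightarrow> 5 * t = n + 4" "real t = (real n + 1) / 5 \<longleftrightarrow> 5 * t = n + 1"
  by (subst of_nat_le_iff[symmetric, where 'a = real] of_nat_eq_iff[symmetric, where 'a = real];
      simp add: field_simps)+

text \<open>Substituting \<open>n = 2 * m + 1 + p - t\<close> turns both
  \<open>5 * t \<le> n + 1\<close> (for \<open>p = 0\<close>) and \<open>5 * t \<le> n + 4\<close>
  (for \<open>p = 1\<close>) into the single condition \<open>3 * t \<le> m + 1 + 2 * p\<close>, so
  the two parities need no separate treatment afterwards.\<close>

lemma two_edge_bound: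
  assumes "n + t = 2 * m + 1 + p" "p \<le> 1"
  shows "2 * edge_bound n t = int n * (int n - 1) -
    (if 3 * t \<le> m + 1 + 2 * p then missing (n + t) t else missing (n + t) m)"
proof (cases "p = 0")
  case True
  then have "odd (n + t)" "5 * t \<le> n + 1 \<longleftrightarrow> 3 * t \<le> m + 1 + 2 * p" "n + t = 2 * m + 1"
    using assms by auto
  then show ?thesis
    using two_int_choose_two[of n] missing_left[of t n] missing_right_odd[of n t m]
    unfolding edge_bound_def threshold_iff by (simp add: algebra_simps)
next
  case False
  then have "p = 1" using assms by simp
  then have "even (n + t)" "5 * t \<le> n + 4 \<longleftrightarrow> 3 * t \<le> m + 1 + 2 * p" "n + t = 2 * m + 2"
    using assms by auto
  then show ?thesis
    using two_int_choose_two[of n] missing_left[of t n] missing_right_even[of n t m]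
    unfolding edge_bound_def threshold_iff by (simp add: algebra_simps)
qed

section \<open>Counting the extremal graphs\<close>

text \<open>The two conditions on \<open>t\<close> have different roles: \<open>t < n\<close> makes
  the range from \<open>t\<close> to \<open>m\<close> nonempty, and \<open>1 \<le> t\<close> ensures
  that the graphs at its ends do have non-Hamiltonian joins.\<close>

lemma extremal_graphs_eq:
  assumes t: "1 \<le> t" "t < n" and m: "n + t = 2 * m + 1 + p" "p \<le> 1"
  shows "extremal_graphs n t = {G. card (verts G) = n \<and>
    (\<exists>i. (i = t \<and> 3 * t \<le> m + 1 + 2 * p \<or> i = m \<and> m + 1 + 2 * p \<le> 3 * t) \<and> split_like t i G)}"
    (is "_ = {G. _ \<and> (\<exists>i. ?I i \<and> _)}")
proof (intro set_eqI iffI)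
  have tm: "t \<le> m" and N: "n + t \<ge> 3" using t m by linarith+
  fix G :: "nat ugraph"
  {
    assume "G \<in> extremal_graphs n t"
    then have nh: "join_nonhamiltonian n t G" and e: "2 * int (card (edges G)) = 2 * edge_bound n t"
      by (auto simp: extremal_graphs_def)
    obtain i where i: "t \<le> i" "2 * i < n + t"
      "2 * int (card (edges G)) \<le> int n * (int n - 1) - missing (n + t) i"
      "2 * int (card (edges G)) = int n * (int n - 1) - missing (n + t) i \<Longrightarrow> split_like t i G"
      using join_nonhamiltonian_edges[OF nh N] by blast
    have im: "i \<le> m" using i m by linarith
    have "missing (n + t) i = (if 3 * t \<le> m + 1 + 2 * p then missing (n + t) t else missing (n + t) m)"
      using missing_ge_left(1)[OF i(1) im, of p] missing_ge_right(1)[OF i(1) im, of p] i(3) e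
      unfolding two_edge_bound[OF m] m(1) by (cases "3 * t \<le> m + 1 + 2 * p") simp_all
    then have "?I i" "split_like t i G"
      using missing_ge_left(2)[OF i(1) im, of p] missing_ge_right(2)[OF i(1) im, of p] i(4) e
      unfolding two_edge_bound[OF m] m(1) by (cases "3 * t \<le> m + 1 + 2 * p"; force)+
    moreover have "card (verts G) = n" using nh by (simp add: join_nonhamiltonian_def)
    ultimately show "G \<in> {G. card (verts G) = n \<and> (\<exists>i. ?I i \<and> split_like t i G)}" by blast
  next
    assume "G \<in> {G. card (verts G) = n \<and> (\<exists>i. ?I i \<and> split_like t i G)}"
    then obtain i where G: "card (verts G) = n" "?I i" "split_like t i G" by blast
    then have "join_nonhamiltonian n t G"
      using split_like_join_nonhamiltonian[of t i G] t tm by auto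
    \<comment> \<open>At the threshold the bound is expressed by the left end, so a graph with
      \<open>i = m\<close> needs the coincidence of the two end values there.\<close>
    moreover have "2 * int (card (edges G)) = 2 * edge_bound n t"
      using split_like_card_edges[OF G(3)] G(2) missing_ge_right(2)[of t t m p] tm
      unfolding two_edge_bound[OF m] G(1) unfolding m(1) by auto
    ultimately show "G \<in> extremal_graphs n t" by (simp add: extremal_graphs_def)
  }
qed

text \<open>The isomorphism classes correspond to the optimal indices \<open>I\<close>: graphs with
  the same index are isomorphic, and the indices \<open>t\<close> and \<open>m\<close>, when both
  occur, give non-isomorphic graphs.\<close>

lemma num_extremal_graphs_eq:
  assumes t: "1 \<le> t" "t < n" and m: "n + t = 2 * m + 1 + p" "p \<le> 1"
  shows "num_extremal_graphs n t = (if 3 * t = m + 1 + 2 * p then 2 else 1)"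
proof -
  define I where "I = {i. i = t \<and> 3 * t \<le> m + 1 + 2 * p \<or> i = m \<and> m + 1 + 2 * p \<le> 3 * t}"
  define r where "r = {(G :: nat ugraph, H :: nat ugraph). graph_iso G H}"
  have tm: "t \<le> m" using t m by linarith
  have equiv: "equiv UNIV r" unfolding r_def by (rule equiv_graph_iso)
  have ext: "extremal_graphs n t = {G. card (verts G) = n \<and> (\<exists>i\<in>I. split_like t i G)}"
    unfolding extremal_graphs_eq[OF assms] I_def by blast
  have "\<exists>G :: nat ugraph. split_like t i G \<and> card (verts G) = n" if "i \<in> I" for i
    using that tm m by (intro split_like_exists) (auto simp: I_def)
  then obtain c :: "nat \<Rightarrow> nat ugraph" where c: "\<And>i. i \<in> I \<Longrightarrow> split_like t i (c i)"
    "\<And>i. i \<in> I \<Longrightarrow> card (verts (c i)) = n" by metis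
  have "extremal_graphs n t // r = (\<lambda>i. r `` {c i}) ` I"
  proof (intro equalityI subsetI)
    fix X assume "X \<in> extremal_graphs n t // r"
    then obtain G i where "X = r `` {G}" "i \<in> I" "split_like t i G" "card (verts G) = n"
      unfolding ext by (auto elim!: quotientE)
    moreover from this have "(G, c i) \<in> r"
      using c split_like_iso[of t i G "c i"] by (simp add: r_def)
    ultimately show "X \<in> (\<lambda>i. r `` {c i}) ` I"
      using equiv_class_eq[OF equiv] by blast
  next
    fix X assume "X \<in> (\<lambda>i. r `` {c i}) ` I"
    then show "X \<in> extremal_graphs n t // r"
      unfolding ext using c by (auto intro!: quotientI)
  qed
  moreover have "inj_on (\<lambda>i. r `` {c i}) I"
  proof (rule inj_onI, rule ccontr)
    fix i j assume ij: "i \<in> I" "j \<in> I" "r `` {c i} = r `` {c j}" "i \<noteq> j"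
    then have "(c i, c j) \<in> r" "(c j, c i) \<in> r"
      using eq_equiv_class[OF _ equiv] by auto
    then have "graph_iso (c i) (c j)" "graph_iso (c j) (c i)" by (simp_all add: r_def)
    moreover have "t \<in> I" "m \<in> I" "t < m" "i = t \<and> j = m \<or> i = m \<and> j = t"
      using ij tm by (auto simp: I_def)
    moreover from this have "\<not> graph_iso (c t) (c m)"
      using c split_like_not_iso[of t "c t" m "c m"] t by simp
    ultimately show False by blast
  qed
  ultimately have "num_extremal_graphs n t = card I"
    unfolding num_extremal_graphs_def r_def[symmetric] by (simp add: card_image)
  also have "\<dots> = (if 3 * t = m + 1 + 2 * p then 2 else 1)"
  proof -
    consider "3 * t < m + 1 + 2 * p" | "3 * t > m + 1 + 2 * p" | "3 * t = m + 1 + 2 * p" by linarith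
    then show ?thesis
    proof cases
      case 1
      then have "I = {t}" by (auto simp: I_def)
      then show ?thesis using 1 by simp
    next
      case 2
      then have "I = {m}" by (auto simp: I_def)
      then show ?thesis using 2 by simp
    next
      case 3
      then have "I = {t, m}" by (auto simp: I_def)
      \<comment> \<open>With \<open>t = m\<close> the threshold equation would read
        \<open>2 * m = 1 + 2 * p\<close>, which fails by parity.\<close>
      moreover have "t \<noteq> m" using 3 by presburger
      ultimately show ?thesis using 3 by simp
    qed
  qed
  finally show ?thesis .
qed

theorem theorem2p1:
  fixes n t :: nat
  shows
    "(\<forall>G :: 'a ugraph. join_nonhamiltonian n t G \<longrightarrow>
        (even (n + t) \<longrightarrow>
           (real t \<le> (real n + 4) / 5 \<longrightarrow>
              int (card (edges G)) \<le>
                int (n choose 2) - (int t * (int n - 1) - int (t choose 2))) \<and>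
           (real t \<ge> (real n + 4) / 5 \<longrightarrow>
              int (card (edges G)) \<le>
                int (n choose 2) - (int (((n + t + 2) div 2) choose 2) - 1))) \<and>
        (odd (n + t) \<longrightarrow>
           (real t \<le> (real n + 1) / 5 \<longrightarrow>
              int (card (edges G)) \<le>
                int (n choose 2) - (int t * (int n - 1) - int (t choose 2))) \<and>
           (real t \<ge> (real n + 1) / 5 \<longrightarrow>
              int (card (edges G)) \<le>
                int (n choose 2) - int (((n + t + 1) div 2) choose 2)))) \<and>
     (1 \<le> t \<and> t < n \<longrightarrow>
        num_extremal_graphs n t =
          (if even (n + t) \<and> real t = (real n + 4) / 5 \<or>
              odd (n + t) \<and> real t = (real n + 1) / 5
           then 2 else 1))"
proof (intro conjI allI impI)
  fix G :: "'a ugraph"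
  assume nh: "join_nonhamiltonian n t G"
  note nn = two_int_choose_two[of n] missing_left[of t n]
  have small: "card (edges G) \<le> n choose 2"
    using card_edges_le_choose[of G] nh by (auto simp: join_nonhamiltonian_def)
  {
    assume "even (n + t)" and "real t \<le> (real n + 4) / 5"
    then have t: "5 * t \<le> n + 4" by (simp only: threshold_iff)
    show "int (card (edges G)) \<le> int (n choose 2) - (int t * (int n - 1) - int (t choose 2))"
    proof (cases "n + t \<ge> 3")
      case True
      have "n + t = 2 * ((n + t) div 2 - 1) + 1 + 1"
        using \<open>even (n + t)\<close> True by presburger
      then obtain m where m: "n + t = 2 * m + 1 + 1" by blast
      then show ?thesis using join_nonhamiltonian_edges_le(1)[OF nh True m] t nn by simp
    next
      \<comment> \<open>Chvatal's theorem requires three vertices. For \<open>n + t \<le> 2\<close>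
        the subtracted term vanishes, here as in the other three cases below, so the trivial bound
        \<open>n choose 2\<close> suffices.\<close>
      case False
      then have "t = 0 \<or> t = 1 \<and> n = 1" using t \<open>even (n + t)\<close> by presburger
      then show ?thesis using small by auto
    qed
  next
    assume "even (n + t)" and "real t \<ge> (real n + 4) / 5"
    then have t: "n + 4 \<le> 5 * t" by (simp only: threshold_iff)
    show "int (card (edges G)) \<le> int (n choose 2) - (int ((n + t + 2) div 2 choose 2) - 1)"
    proof (cases "n + t \<ge> 3")
      case True
      have "n + t = 2 * ((n + t) div 2 - 1) + 1 + 1"
        using \<open>even (n + t)\<close> True by presburger
      then obtain m where m: "n + t = 2 * m + 1 + 1" by blast
      then show ?thesis
        using join_nonhamiltonian_edges_le(2)[OF nh True m] t nn missing_right_even[of n t m] by simp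
    next
      case False
      then have "n + t = 2" using t \<open>even (n + t)\<close> by presburger
      then show ?thesis using small by simp
    qed
  next
    assume "odd (n + t)" and "real t \<le> (real n + 1) / 5"
    then have t: "5 * t \<le> n + 1" by (simp only: threshold_iff)
    show "int (card (edges G)) \<le> int (n choose 2) - (int t * (int n - 1) - int (t choose 2))"
    proof (cases "n + t \<ge> 3")
      case True
      have "n + t = 2 * ((n + t) div 2) + 1 + 0"
        using \<open>odd (n + t)\<close> by presburger
      then obtain m where m: "n + t = 2 * m + 1 + 0" by blast
      then show ?thesis using join_nonhamiltonian_edges_le(1)[OF nh True m] t nn by simp
    next
      case False
      then have "t = 0" using t by presburger
      then show ?thesis using small by simp
    qed
  next
    assume "odd (n + t)" and "real t \<ge> (real n + 1) / 5"
    then have t: "n + 1 \<le> 5 * t" by (simp only: threshold_iff)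
    show "int (card (edges G)) \<le> int (n choose 2) - int ((n + t + 1) div 2 choose 2)"
    proof (cases "n + t \<ge> 3")
      case True
      have "n + t = 2 * ((n + t) div 2) + 1 + 0"
        using \<open>odd (n + t)\<close> by presburger
      then obtain m where m: "n + t = 2 * m + 1 + 0" by blast
      then show ?thesis
        using join_nonhamiltonian_edges_le(2)[OF nh True m] t nn missing_right_odd[of n t m] by simp
    next
      case False
      then have "n + t = 1" using t \<open>odd (n + t)\<close> by presburger
      then show ?thesis using small by (simp add: binomial_eq_0)
    qed
  }
next
  assume t: "1 \<le> t \<and> t < n"
  \<comment> \<open>\<open>m\<close> is the largest integer below half of \<open>n + t\<close>, and
    \<open>p\<close> records the parity so that \<open>n + t = 2 * m + 1 + p\<close>.\<close>
  define p m where "p = (if even (n + t) then 1 else 0 :: nat)" and "m = (n + t - 1) div 2"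
  have "n + t = 2 * m + 1 + p" "p \<le> 1"
    using t unfolding p_def m_def by (simp_all, presburger)
  moreover from this have "3 * t = m + 1 + 2 * p \<longleftrightarrow>
      even (n + t) \<and> 5 * t = n + 4 \<or> odd (n + t) \<and> 5 * t = n + 1"
    unfolding p_def by (auto split: if_splits)
  ultimately show "num_extremal_graphs n t =
      (if even (n + t) \<and> real t = (real n + 4) / 5 \<or> odd (n + t) \<and> real t = (real n + 1) / 5
       then 2 else 1)"
    using num_extremal_graphs_eq[of t n m p] t unfolding threshold_iff by simp
qed

end
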